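(* Let $M$ and $N$ be finite $\langle t\rangle$-modules. Then $\Gamma_{M\wedge N} = \Gamma_M \otimes \Gamma_N$, where the vertex of $\Gamma_{M \wedge N}$ corresponding to a non-zero element $(m,n) \in M\wedge N$ is identified with the pair of vertices $(m,n)$ of $\Gamma_M\otimes\Gamma_N$.
   Context: $\langle t\rangle = \{0,1,t,t^2,\dots\}$ is the free monoid (with absorbing zero) on one generator. A finite $\langle t\rangle$-module is a finite pointed set $(M,0_M)$ with an action of $\langle t\rangle$ fixing $0_M$, with $1$ acting as the identity and $0$ sending everything to $0_M$; equivalently, a finite pointed set with a basepoint-preserving self-map $t$. The elements of $M$ other than $0_M$ are called non-zero. The smash product $M\wedge N = (M\times N)/(M\vee N)$ is obtained from $M \times N$ by identifying all pairs having at least one coordinate equal to the basepoint with a single basepoint, with diagonal action $t\cdot(m,n)=(t\cdot m,t\cdot n)$. The directed graph $\Gamma_M$ has as vertices the non-zero elements of $M$, with a directed edge from $m$ to $t\cdot m$ whenever $t\cdot m\neq 0_M$. For finite directed graphs $\Gamma, \Gamma'$, the tensor product graph $\Gamma\otimes\Gamma'$ is the directed graph whose vertex set is the product of the vertex sets of $\Gamma$ and $\Gamma'$ and whose adjacency matrix is the Kronecker product $\mathrm{Adj}(\Gamma)\otimes \mathrm{Adj}(\Gamma')$; that is, there is a directed edge from $(u,u')$ to $(v,v')$ if and only if there are directed edges $u\to v$ in $\Gamma$ and $u'\to v'$ in $\Gamma'$. *)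

theory Defs
  imports "Graph_Theory.Graph_Theory"
begin

text \<open>\<open>TPow k\<close> is $t^k$, and \<open>TZero\<close> is the absorbing zero.\<close>

datatype tmon = TZero | TPow nat

instantiation tmon :: "{comm_monoid_mult, mult_zero, zero_neq_one}"
begin

definition zero_tmon :: tmon where "zero_tmon = TZero"

definition one_tmon :: tmon where "one_tmon = TPow 0"

fun times_tmon :: "tmon \<Rightarrow> tmon \<Rightarrow> tmon" where
  "times_tmon (TPow i) (TPow j) = TPow (i + j)"
| "times_tmon TZero _ = TZero"
| "times_tmon _ TZero = TZero"

instance
proof
  fix a b c :: tmon
  show "a * b * c = a * (b * c)"
    by (cases a; cases b; cases c) auto
  show "a * b = b * a"
    by (cases a; cases b) auto
  show "1 * a = a"
    by (cases a) (auto simp: one_tmon_def)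
  show "0 * a = 0" "a * 0 = 0"
    by (cases a; simp add: zero_tmon_def)+
  show "(0 :: tmon) \<noteq> 1"
    by (simp add: zero_tmon_def one_tmon_def)
qed

end

definition tgen :: tmon where "tgen = TPow 1"

lemma TPow_eq_tgen_power: "TPow k = tgen ^ k"
proof (induction k)
  case (Suc k)
  have "tgen ^ Suc k = tgen * TPow k"
    by (simp add: Suc)
  then show ?case
    by (simp add: tgen_def)
qed (simp add: one_tmon_def)

record 'a tmodule =
  elems :: "'a set"
  bpt :: 'a
  act :: "tmon \<Rightarrow> 'a \<Rightarrow> 'a"

locale fin_tmodule =
  fixes M :: "'a tmodule"
  assumes finite_elems: "finite (elems M)"
    and bpt_in: "bpt M \<in> elems M"
    and act_in: "m \<in> elems M \<Longrightarrow> act M a m \<in> elems M"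
    and act_one: "m \<in> elems M \<Longrightarrow> act M 1 m = m"
    and act_mult: "m \<in> elems M \<Longrightarrow> act M (a * b) m = act M a (act M b m)"
    and act_zero: "m \<in> elems M \<Longrightarrow> act M 0 m = bpt M"
    and act_bpt: "act M a (bpt M) = bpt M"

definition nonzero :: "'a tmodule \<Rightarrow> 'a set" where
  "nonzero M = elems M - {bpt M}"

definition wedge :: "'a tmodule \<Rightarrow> 'b tmodule \<Rightarrow> ('a \<times> 'b) set" where
  "wedge M N = elems M \<times> {bpt N} \<union> {bpt M} \<times> elems N"

definition smash_rel :: "'a tmodule \<Rightarrow> 'b tmodule \<Rightarrow> (('a \<times> 'b) \<times> ('a \<times> 'b)) set" where
  "smash_rel M N = Id_on (elems M \<times> elems N) \<union> wedge M N \<times> wedge M N"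

text \<open>The class of a pair in the quotient $(M \times N)/(M \vee N)$.\<close>

definition smash_class :: "'a tmodule \<Rightarrow> 'b tmodule \<Rightarrow> 'a \<times> 'b \<Rightarrow> ('a \<times> 'b) set" where
  "smash_class M N p = smash_rel M N `` {p}"

text \<open>
  The action on a class \<open>X\<close> is the union, over all representatives \<open>(m, n)\<close>, of the classes
  of \<open>(a m, a n)\<close>; for modules all these classes coincide (lemma \<open>act_smash_class\<close>).
\<close>

definition smash :: "'a tmodule \<Rightarrow> 'b tmodule \<Rightarrow> ('a \<times> 'b) set tmodule" where
  "smash M N =
     \<lparr> elems = (elems M \<times> elems N) // smash_rel M N,
       bpt = smash_class M N (bpt M, bpt N),
       act = (\<lambda>a X. \<Union>(m, n) \<in> X. smash_class M N (act M a m, act N a n)) \<rparr>"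

lemma equiv_smash_rel:
  assumes "fin_tmodule M" "fin_tmodule N"
  shows "equiv (elems M \<times> elems N) (smash_rel M N)"
proof -
  interpret M: fin_tmodule M by fact
  interpret N: fin_tmodule N by fact
  show ?thesis
    using M.bpt_in N.bpt_in
    by (intro equivI refl_onI symI transI) (auto simp: smash_rel_def wedge_def)
qed

lemma act_smash_class:
  assumes "fin_tmodule M" "fin_tmodule N" "m \<in> elems M" "n \<in> elems N"
  shows "act (smash M N) a (smash_class M N (m, n)) =
    smash_class M N (act M a m, act N a n)"
proof -
  interpret M: fin_tmodule M by fact
  interpret N: fin_tmodule N by fact
  have eq: "equiv (elems M \<times> elems N) (smash_rel M N)"
    using assms equiv_smash_rel by blast
  have "(\<lambda>p. smash_class M N (act M a (fst p), act N a (snd p))) respects smash_rel M N"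
    unfolding smash_class_def
    by (intro congruentI equiv_class_eq[OF eq])
       (auto simp: smash_rel_def wedge_def M.act_in N.act_in M.act_bpt N.act_bpt)
  from UN_equiv_class[OF eq this, of "(m, n)"] show ?thesis
    using assms by (simp add: smash_def smash_class_def case_prod_beta)
qed

lemma fin_tmodule_smash:
  assumes "fin_tmodule M" "fin_tmodule N"
  shows "fin_tmodule (smash M N)"
proof -
  interpret M: fin_tmodule M by fact
  interpret N: fin_tmodule N by fact
  note eq = equiv_smash_rel[OF assms]
  have el: "elems (smash M N) = smash_class M N ` (elems M \<times> elems N)"
    by (auto simp: smash_def quotient_def smash_class_def)
  have bp: "bpt (smash M N) = smash_class M N (bpt M, bpt N)"
    by (simp add: smash_def)
  note acts = act_smash_class[OF assms]
  show ?thesis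
    by unfold_locales
      (auto simp: el bp acts M.finite_elems N.finite_elems M.bpt_in N.bpt_in M.act_in N.act_in
        M.act_one N.act_one M.act_mult N.act_mult M.act_zero N.act_zero M.act_bpt N.act_bpt)
qed

definition module_graph :: "'a tmodule \<Rightarrow> 'a pair_pre_digraph" where
  "module_graph M =
     \<lparr> pverts = nonzero M,
       parcs = {(m, act M tgen m) |m. m \<in> nonzero M \<and> act M tgen m \<noteq> bpt M} \<rparr>"

definition tensor_digraph ::
    "'a pair_pre_digraph \<Rightarrow> 'b pair_pre_digraph \<Rightarrow> ('a \<times> 'b) pair_pre_digraph" where
  "tensor_digraph G H =
     \<lparr> pverts = pverts G \<times> pverts H,
       parcs = {((u, u'), (v, v')) |u u' v v'. (u, v) \<in> parcs G \<and> (u', v') \<in> parcs H} \<rparr>"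

definition adj :: "'a pair_pre_digraph \<Rightarrow> 'a \<Rightarrow> 'a \<Rightarrow> nat" where
  "adj G u v = (if (u, v) \<in> parcs G then 1 else 0)"

lemma adj_tensor_digraph:
  "adj (tensor_digraph G H) (u, u') (v, v') = adj G u v * adj H u' v'"
  by (simp add: adj_def tensor_digraph_def)

lemma pair_fin_digraph_module_graph:
  assumes "fin_tmodule M"
  shows "pair_fin_digraph (module_graph M)"
proof -
  interpret fin_tmodule M by fact
  show ?thesis
    by unfold_locales
      (auto simp: module_graph_def nonzero_def act_in finite_elems
        intro!: finite_subset[OF _ finite_imageI[OF finite_elems, of "\<lambda>m. (m, act M tgen m)"]])
qed

text \<open>Relabelling of the vertices by \<open>f\<close>, as a morphism datum for graphs whose arcs are pairs.\<close>

definition vertex_relabelling ::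
    "('a \<Rightarrow> 'b) \<Rightarrow> ('a, 'a \<times> 'a, 'b, 'b \<times> 'b) digraph_isomorphism" where
  "vertex_relabelling f =
     \<lparr> iso_verts = f, iso_arcs = map_prod f f, iso_head = snd, iso_tail = fst \<rparr>"

end

theory Submission
  imports Defs
begin

text \<open>The quotient collapses the wedge to the basepoint and changes nothing else. Hence
  \<open>smash_class M N\<close> maps pairs of non-zero elements bijectively onto the non-zero
  elements of the smash product (\<open>smash_class_eq_singleton\<close>,
  \<open>nonzero_smash\<close>). The generator acts diagonally, and by
  \<open>smash_class_eq_bpt_iff\<close> the image of (m, n) is non-zero exactly when both
  coordinates of the image are. So an arc leaves (m, n) iff one leaves m and one leaves n, which is
  the arc condition of the tensor product (\<open>parcs_smash\<close>).\<close>

lemma smash_class_eq_singleton: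
  assumes "m \<in> nonzero M" "n \<in> nonzero N"
  shows "smash_class M N (m, n) = {(m, n)}"
  using assms by (auto simp: smash_class_def smash_rel_def wedge_def nonzero_def)

text \<open>Equality of classes amounts to being related, and the pair of basepoints lies in the
  wedge, so exactly the wedge is related to it.\<close>

lemma smash_class_eq_bpt_iff:
  assumes "fin_tmodule M" "fin_tmodule N" "m \<in> elems M" "n \<in> elems N"
  shows "smash_class M N (m, n) = bpt (smash M N) \<longleftrightarrow> m = bpt M \<or> n = bpt N"
proof -
  interpret M: fin_tmodule M by fact
  interpret N: fin_tmodule N by fact
  have "smash_class M N (m, n) = bpt (smash M N) \<longleftrightarrow>
      ((m, n), (bpt M, bpt N)) \<in> smash_rel M N"
    using assms M.bpt_in N.bpt_in
    by (simp add: smash_def smash_class_def eq_equiv_class_iff[OF equiv_smash_rel])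
  also have "\<dots> \<longleftrightarrow> m = bpt M \<or> n = bpt N"
    using assms M.bpt_in N.bpt_in by (auto simp: smash_rel_def wedge_def)
  finally show ?thesis .
qed

lemma nonzero_smash:
  assumes "fin_tmodule M" "fin_tmodule N"
  shows "nonzero (smash M N) = smash_class M N ` (nonzero M \<times> nonzero N)"
proof -
  have "elems (smash M N) = smash_class M N ` (elems M \<times> elems N)"
    by (auto simp: smash_def quotient_def smash_class_def)
  then have "nonzero (smash M N) =
      smash_class M N ` {p \<in> elems M \<times> elems N. smash_class M N p \<noteq> bpt (smash M N)}"
    unfolding nonzero_def by blast
  also have "{p \<in> elems M \<times> elems N. smash_class M N p \<noteq> bpt (smash M N)} =
      nonzero M \<times> nonzero N"
    using smash_class_eq_bpt_iff[OF assms] by (auto simp: nonzero_def)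
  finally show ?thesis .
qed

text \<open>In either graph the source of an arc determines its target, so it suffices to compare,
  source by source, when an arc exists.\<close>

lemma parcs_smash:
  assumes "fin_tmodule M" "fin_tmodule N"
  shows "parcs (module_graph (smash M N)) =
    map_prod (smash_class M N) (smash_class M N) `
      parcs (tensor_digraph (module_graph M) (module_graph N))"
proof -
  interpret M: fin_tmodule M by fact
  interpret N: fin_tmodule N by fact
  let ?c = "smash_class M N"
  have act: "act (smash M N) tgen (?c (m, n)) = ?c (act M tgen m, act N tgen n)"
    and zero: "?c (act M tgen m, act N tgen n) = bpt (smash M N) \<longleftrightarrow>
      act M tgen m = bpt M \<or> act N tgen n = bpt N"
    if "m \<in> nonzero M" "n \<in> nonzero N" for m n
    using that
    by (simp_all add: nonzero_def act_smash_class[OF assms] smash_class_eq_bpt_iff[OF assms]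
        M.act_in N.act_in)
  have "parcs (module_graph (smash M N)) =
      {(?c (m, n), act (smash M N) tgen (?c (m, n))) |m n. m \<in> nonzero M \<and> n \<in> nonzero N \<and>
        act (smash M N) tgen (?c (m, n)) \<noteq> bpt (smash M N)}"
    unfolding module_graph_def nonzero_smash[OF assms] by (simp, blast)
  also have "\<dots> = {(?c (m, n), ?c (act M tgen m, act N tgen n)) |m n. m \<in> nonzero M \<and> n \<in> nonzero N \<and>
        act M tgen m \<noteq> bpt M \<and> act N tgen n \<noteq> bpt N}"
    \<comment> \<open>Negating \<open>zero\<close> turns "the image class is non-zero" into a
      conjunction, one condition per factor.\<close>
    by (intro Collect_cong ex_cong1) (metis act zero)
  also have "\<dots> = map_prod ?c ?c ` parcs (tensor_digraph (module_graph M) (module_graph N))"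
    by (force simp: module_graph_def tensor_digraph_def)
  finally show ?thesis .
qed

lemma wf_digraph_tensor_digraph:
  assumes "pair_wf_digraph G" "pair_wf_digraph H"
  shows "wf_digraph (with_proj (tensor_digraph G H))"
  using assms by (auto simp: wf_digraph_def pair_wf_digraph_def tensor_digraph_def)

theorem proposition3p10:
  fixes M :: "'a tmodule" and N :: "'b tmodule"
  assumes "fin_tmodule M" and "fin_tmodule N"
  shows "let T = with_proj (tensor_digraph (module_graph M) (module_graph N));
             h = vertex_relabelling (smash_class M N)
         in pre_digraph.digraph_isomorphism T h \<and>
            with_proj (module_graph (smash M N)) = app_iso h T"
proof -
  let ?P = "tensor_digraph (module_graph M) (module_graph N)"
  let ?T = "with_proj ?P" and ?c = "smash_class M N"
  have wf: "wf_digraph ?T"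
    using assms by (intro wf_digraph_tensor_digraph pair_fin_digraph.axioms(1)
        pair_fin_digraph_module_graph)
  have verts: "pverts ?P = nonzero M \<times> nonzero N"
    by (simp add: tensor_digraph_def module_graph_def)
  have inj: "inj_on ?c (pverts ?P)"
    unfolding verts by (auto simp: inj_on_def smash_class_eq_singleton)
  \<comment> \<open>Injectivity of \<open>?c\<close> is known on vertices only, so arcs must have
    both endpoints there before it can pass to \<open>map_prod ?c ?c\<close>.\<close>
  have "parcs ?P \<subseteq> pverts ?P \<times> pverts ?P"
    using wf by (auto dest: wf_digraph.head_in_verts wf_digraph.tail_in_verts)
  then have inj_arcs: "inj_on (map_prod ?c ?c) (parcs ?P)"
    using map_prod_inj_on[OF inj inj] inj_on_subset by blast
  have "pre_digraph.digraph_isomorphism ?T (vertex_relabelling ?c)"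
    using wf inj inj_arcs
    by (simp add: pre_digraph.digraph_isomorphism_def vertex_relabelling_def)
  \<comment> \<open>\<open>app_iso\<close> takes images of vertices and arcs, so this is the
    surjectivity half; both graphs use the projections as tail and head.\<close>
  moreover have "with_proj (module_graph (smash M N)) = app_iso (vertex_relabelling ?c) ?T"
    using nonzero_smash[OF assms] parcs_smash[OF assms] verts
    by (simp add: app_iso_def vertex_relabelling_def with_proj_def module_graph_def)
  ultimately show ?thesis
    by (simp add: Let_def)
qed

end
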